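(* Let $\Phi:(S,\cdot)\to(T,\cdot)$ be a semigroup homomorphism such that $\Phi(S)$ is a $J$-set in $T$. If $A\subseteq S$ is a $C$-set in $S$, then $\Phi(A)$ is a $C$-set in $T$.
   Context: For a semigroup $(X,\cdot)$, $B\subseteq X$ and $x\in X$, let $x^{-1}B=\{y\in X:x\cdot y\in B\}$; for a set $Y$, $\mathcal P_f(Y)$ denotes the set of finite nonempty subsets of $Y$. Let $\mathcal T_X={}^{\mathbb N}X$; for $m\in\mathbb N$ let $\mathcal J_m=\{(t(1),\dots,t(m))\in\mathbb N^m:t(1)<\dots<t(m)\}$; for $a\in X^{m+1}$, $t\in\mathcal J_m$, $f\in\mathcal T_X$ put $x(m,a,t,f)=\bigl(\prod_{j=1}^m a(j)\cdot f(t(j))\bigr)\cdot a(m+1)$. A set $B\subseteq X$ is a $J$-set in $X$ if for each $F\in\mathcal P_f(\mathcal T_X)$ there exist $m\in\mathbb N$, $a\in X^{m+1}$, $t\in\mathcal J_m$ with $x(m,a,t,f)\in B$ for every $f\in F$. A family $\langle C_F\rangle_{F\in\mathcal I}$ is downward directed if $(\mathcal I,\geq)$ is directed and $F\geq G$ implies $C_F\subseteq C_G$. A set $A\subseteq X$ is a $C$-set in $X$ if there is a downward directed family $\langle C_F\rangle_{F\in\mathcal I}$ of subsets of $A$ such that (1) for each $F\in\mathcal I$ and each $x\in C_F$ there is $G\in\mathcal I$ with $C_G\subseteq x^{-1}C_F$, and (2) for each $\mathcal F\in\mathcal P_f(\mathcal I)$, $\bigcap_{F\in\mathcal F}C_F$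 is a $J$-set in $X$. *)

theory Defs imports Main begin

text \<open>
  A (nonempty) semigroup is a type of class \<open>semigroup_mult\<close>; \<open>\<nat>\<close> is the set of positive integers.
\<close>

definition left_quot :: "'a::semigroup_mult \<Rightarrow> 'a set \<Rightarrow> 'a set" where
  "left_quot x B = {y. x * y \<in> B}"

text \<open>
  \<open>sg_prod g m = g 1 * g 2 * \<dots> * g m\<close> for \<open>m \<ge> 1\<close>; a semigroup has no empty product.
\<close>
primrec sg_prod :: "(nat \<Rightarrow> 'a::semigroup_mult) \<Rightarrow> nat \<Rightarrow> 'a" where
  "sg_prod g 0 = undefined"
| "sg_prod g (Suc n) = (if n = 0 then g 1 else sg_prod g n * g (Suc n))"

text \<open>
  Tuples of length \<open>m\<close> and sequences indexed by the positive integers are functions on \<open>nat\<close>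
  of which only the values on \<open>{1..m}\<close>, respectively \<open>{1..}\<close>, are ever used.
\<close>
definition incr_tuples :: "nat \<Rightarrow> (nat \<Rightarrow> nat) set" where
  "incr_tuples m = {t. (\<forall>j\<in>{1..m}. 1 \<le> t j) \<and> strict_mono_on {1..m} t}"

definition xprod ::
  "nat \<Rightarrow> (nat \<Rightarrow> 'a::semigroup_mult) \<Rightarrow> (nat \<Rightarrow> nat) \<Rightarrow> (nat \<Rightarrow> 'a) \<Rightarrow> 'a" where
  "xprod m a t f = sg_prod (\<lambda>j. a j * f (t j)) m * a (m + 1)"

definition J_set :: "'a::semigroup_mult set \<Rightarrow> bool" where
  "J_set B \<longleftrightarrow>
    (\<forall>F :: (nat \<Rightarrow> 'a) set. finite F \<and> F \<noteq> {} \<longrightarrow>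
      (\<exists>m\<ge>1. \<exists>a. \<exists>t\<in>incr_tuples m. \<forall>f\<in>F. xprod m a t f \<in> B))"

text \<open>A directed set is nonempty and preordered, as usual.\<close>

definition downward_directed :: "'i set \<Rightarrow> ('i \<Rightarrow> 'i \<Rightarrow> bool) \<Rightarrow> ('i \<Rightarrow> 'a set) \<Rightarrow> bool" where
  "downward_directed I geq C \<longleftrightarrow>
    I \<noteq> {} \<and> reflp_on I geq \<and> transp_on I geq \<and>
    (\<forall>F\<in>I. \<forall>G\<in>I. \<exists>H\<in>I. geq H F \<and> geq H G) \<and>
    (\<forall>F\<in>I. \<forall>G\<in>I. geq F G \<longrightarrow> C F \<subseteq> C G)"

definition C_family ::
  "'a::semigroup_mult set \<Rightarrow> 'i set \<Rightarrow> ('i \<Rightarrow> 'i \<Rightarrow> bool) \<Rightarrow> ('i \<Rightarrow> 'a set) \<Rightarrow> bool" where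
  "C_family A I geq C \<longleftrightarrow>
    downward_directed I geq C \<and>
    (\<forall>F\<in>I. C F \<subseteq> A) \<and>
    (\<forall>F\<in>I. \<forall>x\<in>C F. \<exists>G\<in>I. C G \<subseteq> left_quot x (C F)) \<and>
    (\<forall>\<F>. finite \<F> \<and> \<F> \<noteq> {} \<and> \<F> \<subseteq> I \<longrightarrow> J_set (\<Inter>F\<in>\<F>. C F))"

text \<open>
  HOL cannot quantify existentially over the type of the indices. Taking indices of type
  \<open>'a set\<close> loses nothing: by \<open>C_set_if_C_family\<close>, a family indexed by any type will do.
\<close>
definition C_set :: "'a::semigroup_mult set \<Rightarrow> bool" where
  "C_set A \<longleftrightarrow> (\<exists>(I :: 'a set set) geq C. C_family A I geq C)"

lemma C_set_if_C_family:
  fixes I :: "'i set" and A :: "'a::semigroup_mult set"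
  assumes "C_family A I geq C"
  shows "C_set A"
proof -
  have ne: "I \<noteq> {}"
    and dir: "\<And>F G. F \<in> I \<Longrightarrow> G \<in> I \<Longrightarrow> \<exists>H\<in>I. C H \<subseteq> C F \<and> C H \<subseteq> C G"
    and sub: "\<And>F. F \<in> I \<Longrightarrow> C F \<subseteq> A"
    and quot: "\<And>F x. F \<in> I \<Longrightarrow> x \<in> C F \<Longrightarrow> \<exists>G\<in>I. C G \<subseteq> left_quot x (C F)"
    and J: "\<And>\<F>. finite \<F> \<Longrightarrow> \<F> \<noteq> {} \<Longrightarrow> \<F> \<subseteq> I \<Longrightarrow> J_set (\<Inter>F\<in>\<F>. C F)"
    using assms unfolding C_family_def downward_directed_def by (blast, meson, blast+)
  have J': "J_set (\<Inter>D\<in>\<D>. D)" if D: "finite \<D>" "\<D> \<noteq> {}" "\<D> \<subseteq> C ` I" for \<D>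
  proof -
    obtain \<F> where "\<F> \<subseteq> I" "finite \<F>" "\<D> = C ` \<F>"
      using finite_subset_image[OF D(1,3)] by blast
    then show ?thesis using J[of \<F>] D(2) by auto
  qed
  have "C_family A (C ` I) (\<lambda>D E. D \<subseteq> E) (\<lambda>D. D)"
    unfolding C_family_def downward_directed_def
    using ne dir sub quot J'
    by (intro conjI) (auto intro: reflp_onI transp_onI)
  then show ?thesis unfolding C_set_def by blast
qed

end

theory Submission imports Defs begin

text \<open>
  The point is that \<open>\<Phi>\<close> maps \<open>J\<close>-sets to \<open>J\<close>-sets; then the images \<open>\<Phi>(C\<^sub>F)\<close> of a family witnessing
  that \<open>A\<close> is a \<open>C\<close>-set do the same for \<open>\<Phi>(A)\<close>. Given finitely many sequences \<open>f\<close> in \<open>T\<close>, apply the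
  \<open>J\<close>-set property of \<open>\<Phi>(S)\<close> to their tails again and again. This yields consecutive blocks of
  indices and, for each block \<open>i\<close>, an expression \<open>x(m\<^sub>i, a\<^sub>i, t\<^sub>i, f) = \<Phi>(g\<^sub>f(i))\<close> with indices in that
  block. The \<open>J\<close>-set property of \<open>B\<close> for the sequences \<open>g\<^sub>f\<close> gives products \<open>x(m, b, s, g\<^sub>f)\<close> in \<open>B\<close>, and
  substituting the blocks into their images under \<open>\<Phi>\<close> yields expressions of the same form in \<open>f\<close>.
\<close>

text \<open>
  \<open>xform n p k\<close>: \<open>p\<close> is some \<open>f \<mapsto> x(m, a, t, f)\<close> with \<open>n < t(1)\<close> and \<open>t(m) = k\<close>. The inductive form
  spares the explicit concatenation of tuples.
\<close>
inductive xform :: "nat \<Rightarrow> ((nat \<Rightarrow> 'a::semigroup_mult) \<Rightarrow> 'a) \<Rightarrow> nat \<Rightarrow> bool" for n where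
  single: "n < k \<Longrightarrow> xform n (\<lambda>f. c * f k * d) k"
| snoc: "xform n p k \<Longrightarrow> k < l \<Longrightarrow> xform n (\<lambda>f. p f * f l * d) l"

lemma xform_less: "xform n p k \<Longrightarrow> n < k"
  by (induction rule: xform.induct) auto

lemma xform_mono: "xform n p k \<Longrightarrow> n' \<le> n \<Longrightarrow> xform n' p k"
  by (induction rule: xform.induct) (auto intro: xform.intros)

lemma xform_mult_left: "xform n p k \<Longrightarrow> xform n (\<lambda>f. c * p f) k"
proof (induction rule: xform.induct)
  case (single k c' d)
  then show ?case using xform.single[of n k "c * c'" d] by (simp add: mult.assoc)
next
  case (snoc p k l d)
  then show ?case using xform.snoc[of n "\<lambda>f. c * p f" k l d] by (simp add: mult.assoc)
qed

lemma xform_mult_right: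
  assumes "xform n p k"
  shows "xform n (\<lambda>f. p f * c) k"
  using assms
proof cases
  case (single c' d)
  then show ?thesis using xform.single[of n k c' "d * c"] by (simp add: mult.assoc)
next
  case (snoc p' k' d)
  then show ?thesis using xform.snoc[of n p' k' k "d * c"] by (simp add: mult.assoc)
qed

text \<open>This is concatenation of tuples. The trailing constant of \<open>p\<close> and the
  leading constant of \<open>q\<close> merge into one coefficient, and \<open>k \<le> k'\<close>
  keeps the indices increasing across the seam.\<close>

lemma xform_mult:
  assumes "xform k' q l" and p: "xform n p k" and le: "k \<le> k'"
  shows "xform n (\<lambda>f. p f * q f) l"
  using assms(1)
proof (induction rule: xform.induct)
  case (single l c d)
  then show ?case
    using xform.snoc[OF xform_mult_right[OF p, of c], of l d] le by (simp add: mult.assoc)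
next
  case (snoc q j l d)
  then show ?case using xform.snoc[OF snoc.IH, of l d] by (simp add: mult.assoc)
qed

lemma sg_prod_cong: "(\<And>j. j \<in> {1..m} \<Longrightarrow> g j = h j) \<Longrightarrow> sg_prod g m = sg_prod h m"
proof (induction m)
  case (Suc m)
  then show ?case by (cases m) auto
qed simp

lemma xprod_Suc:
  "m \<ge> 1 \<Longrightarrow> xprod (Suc m) a t f = xprod m a t f * f (t (Suc m)) * a (Suc (Suc m))"
  by (simp add: xprod_def mult.assoc)

lemma xprod_cong:
  assumes "\<And>j. j \<in> {1..Suc m} \<Longrightarrow> a j = b j" "\<And>j. j \<in> {1..m} \<Longrightarrow> f (s j) = g (t j)"
  shows "xprod m a s f = xprod m b t g"
proof -
  have "sg_prod (\<lambda>j. a j * f (s j)) m = sg_prod (\<lambda>j. b j * g (t j)) m"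
    using assms by (intro sg_prod_cong) auto
  then show ?thesis using assms(1)[of "Suc m"] by (simp add: xprod_def)
qed

lemma xform_xprod:
  assumes "m \<ge> 1" "t \<in> incr_tuples m" "\<forall>j\<in>{1..m}. n < t j"
  shows "xform n (xprod m a t) (t m)"
  using assms
proof (induction m rule: nat_induct_at_least)
  case base
  have "xprod 1 a t = (\<lambda>f. a 1 * f (t 1) * a 2)"
    by (auto simp: xprod_def numeral_2_eq_2)
  then show ?case using base xform.single by auto
next
  case (Suc m)
  have "t \<in> incr_tuples m" and lt: "t m < t (Suc m)"
    using Suc.prems \<open>1 \<le> m\<close> by (auto simp: incr_tuples_def strict_mono_on_def)
  then have "xform n (xprod m a t) (t m)" using Suc by auto
  moreover have "xprod (Suc m) a t = (\<lambda>f. xprod m a t f * f (t (Suc m)) * a (Suc (Suc m)))"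
    using xprod_Suc[OF \<open>1 \<le> m\<close>] by (rule ext)
  ultimately show ?case using lt by (simp only: xform.snoc)
qed

lemma xform_imp_xprod:
  assumes "xform n p k"
  shows "\<exists>m\<ge>1. \<exists>a. \<exists>t\<in>incr_tuples m. t m = k \<and> p = xprod m a t"
  using assms
proof (induction rule: xform.induct)
  case (single k c d)
  have "(\<lambda>f. c * f k * d) = xprod 1 (\<lambda>j. if j = 1 then c else d) (\<lambda>_. k)"
    by (auto simp: xprod_def)
  moreover have "(\<lambda>_. k) \<in> incr_tuples 1"
    using single by (auto simp: incr_tuples_def strict_mono_on_def)
  ultimately show ?case by (intro exI[of _ 1]) auto
next
  case (snoc p k l d)
  then obtain m a t where m: "m \<ge> 1" and t: "t \<in> incr_tuples m" "t m = k" and p: "p = xprod m a t"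
    by blast
  define a' where "a' = a(Suc (Suc m) := d)"
  define t' where "t' = t(Suc m := l)"
  \<comment> \<open>All old indices are at most the last one, \<open>k\<close>, so appending
    \<open>l\<close> above \<open>k\<close> keeps the tuple increasing.\<close>
  have "t j \<le> k" if "j \<in> {1..m}" for j
    using that t by (cases "j = m") (auto simp: incr_tuples_def strict_mono_on_def intro: less_imp_le)
  then have "t' \<in> incr_tuples (Suc m)"
    using t \<open>k < l\<close> by (fastforce simp: incr_tuples_def strict_mono_on_def t'_def le_Suc_eq)
  moreover have "(\<lambda>f. p f * f l * d) = xprod (Suc m) a' t'"
  proof
    fix f
    have "xprod m a t f = xprod m a' t' f"
      by (intro xprod_cong) (auto simp: a'_def t'_def)
    then show "p f * f l * d = xprod (Suc m) a' t' f"
      using m by (simp add: p xprod_Suc) (simp add: a'_def t'_def)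
  qed
  moreover have "t' (Suc m) = l" by (simp add: t'_def)
  ultimately show ?case by (intro exI[of _ "Suc m"] conjI exI[of _ a'] bexI[of _ t']) auto
qed

text \<open>Applying the definition to the sequences shifted by \<open>n\<close> forces all indices
  above any prescribed \<open>n\<close>. Conversely, \<open>n = 0\<close> is exactly the positivity
  of indices.\<close>

lemma J_set_iff_xform:
  "J_set B \<longleftrightarrow> (\<forall>F n. finite F \<and> F \<noteq> {} \<longrightarrow> (\<exists>p k. xform n p k \<and> (\<forall>f\<in>F. p f \<in> B)))"
proof
  assume J: "J_set B"
  show "\<forall>F n. finite F \<and> F \<noteq> {} \<longrightarrow> (\<exists>p k. xform n p k \<and> (\<forall>f\<in>F. p f \<in> B))"
  proof (intro allI impI)
    fix F :: "(nat \<Rightarrow> 'a) set" and n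
    assume "finite F \<and> F \<noteq> {}"
    then have "finite ((\<lambda>f i. f (i + n)) ` F) \<and> (\<lambda>f i. f (i + n)) ` F \<noteq> {}" by simp
    then obtain m a t where m: "m \<ge> 1" and t: "t \<in> incr_tuples m"
      and B: "\<forall>f\<in>F. xprod m a t (\<lambda>i. f (i + n)) \<in> B"
      using J[unfolded J_set_def, rule_format, of "(\<lambda>f i. f (i + n)) ` F"] by auto
    define t' where "t' j = t j + n" for j
    have "t' \<in> incr_tuples m" "\<forall>j\<in>{1..m}. n < t' j"
      using t by (auto simp: t'_def incr_tuples_def strict_mono_on_def)
    then have "xform n (xprod m a t') (t' m)" using m by (intro xform_xprod)
    moreover have "xprod m a t (\<lambda>i. f (i + n)) = xprod m a t' f" for f
      by (intro xprod_cong) (auto simp: t'_def)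
    ultimately show "\<exists>p k. xform n p k \<and> (\<forall>f\<in>F. p f \<in> B)" using B by auto
  qed
next
  assume xf: "\<forall>F n. finite F \<and> F \<noteq> {} \<longrightarrow> (\<exists>p k. xform n p k \<and> (\<forall>f\<in>F. p f \<in> B))"
  show "J_set B" unfolding J_set_def
  proof (intro allI impI)
    fix F :: "(nat \<Rightarrow> 'a) set"
    assume "finite F \<and> F \<noteq> {}"
    with xf obtain p k where p: "xform 0 p k" "\<forall>f\<in>F. p f \<in> B" by blast
    obtain m a t where "m \<ge> 1" "t \<in> incr_tuples m" "p = xprod m a t"
      using xform_imp_xprod[OF p(1)] by blast
    with p(2) show "\<exists>m\<ge>1. \<exists>a. \<exists>t\<in>incr_tuples m. \<forall>f\<in>F. xprod m a t f \<in> B" by blast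
  qed
qed

lemma J_set_mono: "J_set B \<Longrightarrow> B \<subseteq> B' \<Longrightarrow> J_set B'"
  unfolding J_set_def by (meson subsetD)

text \<open>Under \<open>\<Phi>\<close>, the constants of \<open>q\<close> become constants of the
  target and each factor \<open>g f i\<close> becomes \<open>p i f\<close>, whose indices lie above
  \<open>s i\<close> and end at \<open>s (Suc i)\<close>. Increasing indices in \<open>q\<close>
  thus select disjoint blocks in increasing order.\<close>

lemma xform_subst:
  fixes \<Phi> :: "'s::semigroup_mult \<Rightarrow> 't::semigroup_mult"
  assumes "xform n q k"
    and hom: "\<And>x y. \<Phi> (x * y) = \<Phi> x * \<Phi> y"
    and block: "\<And>i. xform (s i) (p i) (s (Suc i))"
    and g: "\<And>f i. f \<in> F \<Longrightarrow> \<Phi> (g f i) = p i f"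
  shows "\<exists>r. xform (s n) r (s (Suc k)) \<and> (\<forall>f\<in>F. \<Phi> (q (g f)) = r f)"
  using assms(1)
proof (induction rule: xform.induct)
  have "strict_mono s" using block xform_less by (auto simp: strict_mono_Suc_iff)
  then have mono: "i \<le> j \<Longrightarrow> s i \<le> s j" for i j by (simp add: strict_mono_less_eq)
  {
    case (single k c d)
    have "xform (s n) (\<lambda>f. \<Phi> c * p k f * \<Phi> d) (s (Suc k))"
      using single mono
      by (intro xform_mult_right xform_mult_left xform_mono[OF block]) simp
    then show ?case using g by (intro exI conjI) (auto simp: hom)
  next
    case (snoc q k l d)
    then obtain r where r: "xform (s n) r (s (Suc k))" "\<forall>f\<in>F. \<Phi> (q (g f)) = r f" by blast
    \<comment> \<open>From \<open>k < l\<close> follows \<open>s (Suc k) \<le> s l\<close>, so block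
      \<open>l\<close> begins no earlier than \<open>r\<close> ends.\<close>
    have "xform (s n) (\<lambda>f. r f * p l f * \<Phi> d) (s (Suc l))"
      using snoc mono by (intro xform_mult_right xform_mult[OF block r(1)]) simp
    then show ?case using g r(2) by (intro exI conjI) (auto simp: hom)
  }
qed

lemma J_set_image:
  fixes \<Phi> :: "'s::semigroup_mult \<Rightarrow> 't::semigroup_mult"
  assumes hom: "\<And>x y. \<Phi> (x * y) = \<Phi> x * \<Phi> y"
    and range: "J_set (range \<Phi>)" and B: "J_set B"
  shows "J_set (\<Phi> ` B)"
  unfolding J_set_iff_xform
proof (intro allI impI)
  fix F :: "(nat \<Rightarrow> 't) set" and n
  assume F: "finite F \<and> F \<noteq> {}"
  then have "\<forall>i. \<exists>p k. xform i p k \<and> (\<forall>f\<in>F. p f \<in> range \<Phi>)"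
    using range unfolding J_set_iff_xform by blast
  then obtain P K where P: "\<And>i. xform i (P i) (K i)" "\<And>i f. f \<in> F \<Longrightarrow> P i f \<in> range \<Phi>"
    by metis
  \<comment> \<open>Iterating \<open>K\<close> starts each block where the previous one
    ends.\<close>
  define s where "s i = (K ^^ i) n" for i
  define p where "p i = P (s i)" for i
  \<comment> \<open>Any preimage will do; one exists whenever \<open>f \<in> F\<close>.\<close>
  define g where "g f i = inv \<Phi> (p i f)" for f i
  have block: "xform (s i) (p i) (s (Suc i))" for i using P(1) by (simp add: s_def p_def)
  have g: "\<Phi> (g f i) = p i f" if "f \<in> F" for f i
    using P(2)[OF that] by (simp add: g_def p_def f_inv_into_f)
  have "finite (g ` F) \<and> g ` F \<noteq> {}" using F by simp
  \<comment> \<open>The bound 0 suffices here: the blocks start at \<open>s 0 = n\<close>, so the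
    substituted expression lies above \<open>n\<close>.\<close>
  then obtain q k where q: "xform 0 q k" "\<forall>h\<in>g ` F. q h \<in> B"
    using B unfolding J_set_iff_xform by blast
  from xform_subst[where \<Phi> = \<Phi> and s = s and p = p and F = F and g = g, OF q(1) hom block g]
  obtain r where "xform (s 0) r (s (Suc k))" "\<forall>f\<in>F. \<Phi> (q (g f)) = r f" by blast
  then show "\<exists>p k. xform n p k \<and> (\<forall>f\<in>F. p f \<in> \<Phi> ` B)"
    using q(2) by (intro exI[of _ r] exI[of _ "s (Suc k)"]) (force simp: s_def)
qed

theorem theorem3p5:
  fixes \<Phi> :: "'s::semigroup_mult \<Rightarrow> 't::semigroup_mult" and A :: "'s set"
  assumes hom: "\<And>x y. \<Phi> (x * y) = \<Phi> x * \<Phi> y"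
    and range: "J_set (range \<Phi>)"
    and A: "C_set A"
  shows "C_set (\<Phi> ` A)"
proof -
  obtain I :: "'s set set" and geq C where "C_family A I geq C"
    using A unfolding C_set_def by blast
  then have dir: "downward_directed I geq C" and sub: "\<forall>F\<in>I. C F \<subseteq> A"
    and quotC: "\<forall>F\<in>I. \<forall>x\<in>C F. \<exists>G\<in>I. C G \<subseteq> left_quot x (C F)"
    and JC: "\<And>\<F>. finite \<F> \<and> \<F> \<noteq> {} \<and> \<F> \<subseteq> I \<Longrightarrow> J_set (\<Inter>F\<in>\<F>. C F)"
    unfolding C_family_def by simp_all
  have dir': "downward_directed I geq (\<lambda>F. \<Phi> ` C F)"
    using dir unfolding downward_directed_def by (simp add: image_mono)
  have quot: "\<exists>G\<in>I. \<Phi> ` C G \<subseteq> left_quot y (\<Phi> ` C F)" if F: "F \<in> I" and y: "y \<in> \<Phi> ` C F" for F y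
  proof -
    from y obtain x where x: "x \<in> C F" "y = \<Phi> x" by blast
    obtain G where "G \<in> I" "C G \<subseteq> left_quot x (C F)"
      using quotC F x(1) by blast
    then show ?thesis
      using x(2) by (intro bexI[of _ G]) (auto simp: left_quot_def hom[symmetric])
  qed
  \<comment> \<open>The image of an intersection may be smaller than the intersection of the images,
    but a superset of a \<open>J\<close>-set is a \<open>J\<close>-set.\<close>
  have J: "J_set (\<Inter>F\<in>\<F>. \<Phi> ` C F)" if "finite \<F> \<and> \<F> \<noteq> {} \<and> \<F> \<subseteq> I" for \<F>
  proof (rule J_set_mono)
    show "J_set (\<Phi> ` (\<Inter>F\<in>\<F>. C F))"
      using hom range JC[OF that] by (rule J_set_image)
  qed blast
  have "C_family (\<Phi> ` A) I geq (\<lambda>F. \<Phi> ` C F)"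
    using dir' sub quot J unfolding C_family_def by (simp add: image_mono)
  \<comment> \<open>The indices are still sets in the source semigroup, so the family has to be
    reindexed.\<close>
  then show ?thesis by (rule C_set_if_C_family)
qed

end
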